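(* Let $L>0$, $f\in\mathcal F_L(\mathbb R^n)$, $x_0\in\mathbb R^n$, and let $(x^{(k)})_{k\in\mathbb N}$ be the trajectory of the accelerated gradient method (defined in the context) with initial point $x_0$ and parameters $(A_k)_{k\in\mathbb N}$ satisfying the step-size condition stated there. For $k\ge1$ define $$q^{(k)}:=-Q_k\,(x^{(k)}-x_0),\qquad Q_k:=\frac{4A_k}{\sum_{i=1}^kA_i\,\delta^+A_{i-1}}.$$ Then: (a) For all $k\ge1$, $q^{(k)}\in\operatorname{dom} f^*$. Suppose moreover that $\operatorname{dom} f^*$ has a minimum-norm point $p^\star$. Then: (b) For all $k\ge1$, $$\|q^{(k)}-p^\star\|^2\le\tilde B_kD_f(x_0,p^\star)=\mathcal O(k^{-2}),\qquad \tilde B_k:=8\left(\frac{\sum_{i=1}^k\sqrt{A_i}\,\delta^+A_{i-1}}{\sum_{i=1}^kA_i\,\delta^+A_{i-1}}\right)^2.$$ (c) If additionally $p^\star\ne0$, then for all $k\ge1$, $$\|q^{(k)}\|^2-\|p^\star\|^2\le\tilde C'_kD_f(x_0,p^\star)+\frac{\tilde C_k^2D_f(x_0,p^\star)^2}{\|p^\star\|^2}=\mathcal O(k^{-2}\log k),$$ where $$\tilde C_k:=\frac{A_k}{\sum_{i=1}^kA_i\,\delta^+A_{i-1}}\left(\frac{A_1\langle\nabla f(x_0)-p^\star,p^\star\rangle}{D_f(x_0,p^\star)}+4\sum_{i=1}^{k-1}\frac{\delta^+A_i}{A_i}\right),\qquad \tilde C'_k:=\tilde B_k+2\tilde C_k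.$$
   Context: $\mathbb N$ is the set of nonnegative integers; $\|\cdot\|$ and $\langle\cdot,\cdot\rangle$ are the Euclidean norm and inner product on $\mathbb R^n$. For $L>0$, $\mathcal F_L(\mathbb R^n)$ is the set of finite-valued differentiable convex functions $f:\mathbb R^n\to\mathbb R$ whose gradient is $L$-Lipschitz. The Legendre--Fenchel conjugate is $f^*(p):=\sup_{x\in\mathbb R^n}\{\langle p,x\rangle-f(x)\}\in\mathbb R\cup\{\infty\}$, and $\operatorname{dom} f^*:=\{p: f^*(p)<\infty\}$ (convex, nonempty, not necessarily closed). The dual divergence is $D_f(x,p):=f(x)+f^*(p)-\langle p,x\rangle$. Accelerated gradient method: let $(A_k)_{k\in\mathbb N}$ be real numbers with $\delta^+A_k:=A_{k+1}-A_k$ satisfying the step-size condition $$A_0=0,\qquad 0<\delta^+A_k\le 2\sqrt{A_{k+1}/L}\ \ (\forall k\in\mathbb N),\qquad \delta^+A_k=\Theta(k).$$ Set $x^{(0)}:=y^{(0)}:=x_0$ and, for $k\in\mathbb N$, $$x^{(k+1)}:=y^{(k)}-\frac{(\delta^+A_k)^2}{4A_{k+1}}\nabla f(y^{(k)}),\qquad y^{(k+1)}:=x^{(k+1)}+\frac{A_k\,\delta^+A_{k+1}}{A_{k+2}\,\delta^+A_k}\,(x^{(k+1)}-x^{(k)}).$$ *)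

theory Defs
  imports "HOL-Analysis.Analysis" "HOL-Library.Landau_Symbols"
begin

definition gradient :: "('a::euclidean_space \<Rightarrow> real) \<Rightarrow> 'a \<Rightarrow> 'a" where
  "gradient f x = (THE D. GDERIV f x :> D)"

lemma GDERIV_unique:
  fixes f :: "'a::euclidean_space \<Rightarrow> real"
  assumes "GDERIV f x :> D" "GDERIV f x :> D'"
  shows "D = D'"
proof -
  have "(\<lambda>h. h \<bullet> D) = (\<lambda>h. h \<bullet> D')"
    using assms unfolding gderiv_def by (rule has_derivative_unique)
  then have "h \<bullet> D = h \<bullet> D'" for h
    by (rule fun_cong)
  then show ?thesis
    using vector_eq_rdot[of D D'] by (simp add: inner_commute)
qed

lemma GDERIV_gradient:
  fixes f :: "'a::euclidean_space \<Rightarrow> real"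
  assumes "f differentiable (at x)"
  shows "GDERIV f x :> gradient f x"
proof -
  obtain f' where f': "(f has_derivative f') (at x)"
    using assms by (auto simp: differentiable_def)
  then have "linear f'"
    by (rule has_derivative_linear)
  then have "f' = (\<lambda>h. h \<bullet> adjoint f' 1)"
    by (auto simp: adjoint_works)
  then have "GDERIV f x :> adjoint f' 1"
    using f' unfolding gderiv_def by simp
  then show ?thesis
    unfolding gradient_def by (rule theI) (erule GDERIV_unique, fact)
qed

definition smooth_convex :: "real \<Rightarrow> ('a::euclidean_space \<Rightarrow> real) set" where
  "smooth_convex L = {f. convex_on UNIV f \<and> (\<forall>x. f differentiable (at x)) \<and>
     L-lipschitz_on UNIV (gradient f)}"

definition conjugate :: "('a::euclidean_space \<Rightarrow> real) \<Rightarrow> 'a \<Rightarrow> ereal" where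
  "conjugate f p = (SUP x. ereal (p \<bullet> x - f x))"

definition conj_dom :: "('a::euclidean_space \<Rightarrow> real) \<Rightarrow> 'a set" where
  "conj_dom f = {p. conjugate f p < \<infinity>}"

definition dual_divergence :: "('a::euclidean_space \<Rightarrow> real) \<Rightarrow> 'a \<Rightarrow> 'a \<Rightarrow> ereal" where
  "dual_divergence f x p = ereal (f x) + conjugate f p - ereal (p \<bullet> x)"

(* real_of_ereal loses nothing when applied to the dual divergence at a point of
   the conjugate's domain. *)
lemma dual_divergence_finite:
  assumes "p \<in> conj_dom f"
  shows "ereal (real_of_ereal (dual_divergence f x p)) = dual_divergence f x p"
proof -
  have "ereal (p \<bullet> x - f x) \<le> conjugate f p"
    unfolding conjugate_def by (rule SUP_upper) simp
  then show ?thesis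
    using assms unfolding dual_divergence_def conj_dom_def
    by (cases "conjugate f p") auto
qed

definition min_norm_point :: "'a::euclidean_space set \<Rightarrow> 'a \<Rightarrow> bool" where
  "min_norm_point S p \<longleftrightarrow> p \<in> S \<and> (\<forall>q\<in>S. norm p \<le> norm q)"

definition fdiff :: "(nat \<Rightarrow> real) \<Rightarrow> nat \<Rightarrow> real" where
  "fdiff A k = A (k + 1) - A k"

definition step_size_condition :: "real \<Rightarrow> (nat \<Rightarrow> real) \<Rightarrow> bool" where
  "step_size_condition L A \<longleftrightarrow>
     A 0 = 0 \<and>
     (\<forall>k. 0 < fdiff A k \<and> fdiff A k \<le> 2 * sqrt (A (k + 1) / L)) \<and>
     fdiff A \<in> \<Theta>(\<lambda>k. real k)"

fun agm_x :: "('a::euclidean_space \<Rightarrow> real) \<Rightarrow> (nat \<Rightarrow> real) \<Rightarrow> 'a \<Rightarrow> nat \<Rightarrow> 'a"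
and agm_y :: "('a::euclidean_space \<Rightarrow> real) \<Rightarrow> (nat \<Rightarrow> real) \<Rightarrow> 'a \<Rightarrow> nat \<Rightarrow> 'a" where
  "agm_x f A x0 0 = x0"
| "agm_x f A x0 (Suc k) = agm_y f A x0 k
     - ((fdiff A k)\<^sup>2 / (4 * A (k + 1))) *\<^sub>R gradient f (agm_y f A x0 k)"
| "agm_y f A x0 0 = x0"
| "agm_y f A x0 (Suc k) = agm_x f A x0 (Suc k)
     + ((A k * fdiff A (k + 1)) / (A (k + 2) * fdiff A k)) *\<^sub>R
       (agm_x f A x0 (Suc k) - agm_x f A x0 k)"

definition Q_coeff :: "(nat \<Rightarrow> real) \<Rightarrow> nat \<Rightarrow> real" where
  "Q_coeff A k = 4 * A k / (\<Sum>i=1..k. A i * fdiff A (i - 1))"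

definition q_seq :: "('a::euclidean_space \<Rightarrow> real) \<Rightarrow> (nat \<Rightarrow> real) \<Rightarrow> 'a \<Rightarrow> nat \<Rightarrow> 'a" where
  "q_seq f A x0 k = - (Q_coeff A k *\<^sub>R (agm_x f A x0 k - x0))"

definition B_tilde :: "(nat \<Rightarrow> real) \<Rightarrow> nat \<Rightarrow> real" where
  "B_tilde A k = 8 * ((\<Sum>i=1..k. sqrt (A i) * fdiff A (i - 1)) /
                      (\<Sum>i=1..k. A i * fdiff A (i - 1)))\<^sup>2"

(* If the divergence vanishes then p is the gradient of f at x0, so the first
   quotient is 0/0; division by zero makes it 0. *)
definition C_tilde ::
  "('a::euclidean_space \<Rightarrow> real) \<Rightarrow> (nat \<Rightarrow> real) \<Rightarrow> 'a \<Rightarrow> 'a \<Rightarrow> nat \<Rightarrow> real" where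
  "C_tilde f A x0 p k = A k / (\<Sum>i=1..k. A i * fdiff A (i - 1)) *
     (A 1 * ((gradient f x0 - p) \<bullet> p) / real_of_ereal (dual_divergence f x0 p)
      + 4 * (\<Sum>i=1..<k. fdiff A i / A i))"

definition C_tilde' ::
  "('a::euclidean_space \<Rightarrow> real) \<Rightarrow> (nat \<Rightarrow> real) \<Rightarrow> 'a \<Rightarrow> 'a \<Rightarrow> nat \<Rightarrow> real" where
  "C_tilde' f A x0 p k = B_tilde A k + 2 * C_tilde f A x0 p k"

end

theory Submission
  imports Defs "HOL-Real_Asymp.Real_Asymp"
begin

text \<open>
  Put \<open>z k = x0 - (1/4) (\<Sum>i<k. a i *\<^sub>R \<nabla>f (y i))\<close> with \<open>a = fdiff A\<close>. Both \<open>x (k+1)\<close> and \<open>y k\<close> are weighted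
  averages of \<open>x k\<close> with \<open>z (k+1)\<close> and \<open>z k\<close> respectively, and consequently \<open>q k\<close> is a convex
  combination, with weights proportional to \<open>A i * a (i-1)\<close>, of the averaged gradients
  \<open>-4 (z i - x0) / A i\<close>; these lie in the convex set \<open>dom f*\<close>.

  Let \<open>p\<close> be the minimum-norm point, \<open>h = D_f(_, p) \<ge> 0\<close> and \<open>\<theta> k = \<langle>\<nabla>f (y k) - p, p\<rangle> \<ge> 0\<close>. The function
  \<open>E k = \<parallel>z k - x0 + (A k / 4) p\<parallel>\<^sup>2 / 2 + (A k / 4) h (x k)\<close> satisfies
  \<open>E (k+1) - E k \<le> (a k / 4) h x0 - (a k * A k / 16) \<theta> k\<close>. Summing gives both
  \<open>\<parallel>averaged gradient - p\<parallel>\<^sup>2 \<le> 8 h x0 / A k\<close>, whence (b), and \<open>(\<Sum>i<k. a i * A i * \<theta> i) \<le> 4 A k * h x0\<close>,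
  which bounds \<open>\<langle>q k - p, p\<rangle>\<close> after summation by parts, whence (c).
\<close>

section \<open>Smooth convex functions\<close>

lemma has_real_derivative_along_line:
  fixes f :: "'a::euclidean_space \<Rightarrow> real"
  assumes "f differentiable (at (y + t *\<^sub>R d))"
  shows "((\<lambda>t. f (y + t *\<^sub>R d)) has_real_derivative gradient f (y + t *\<^sub>R d) \<bullet> d) (at t)"
proof -
  have f: "(f has_derivative (\<lambda>h. h \<bullet> gradient f (y + t *\<^sub>R d))) (at (y + t *\<^sub>R d))"
    using GDERIV_gradient[OF assms] by (simp add: gderiv_def)
  have line: "((\<lambda>t. y + t *\<^sub>R d) has_derivative (\<lambda>t. t *\<^sub>R d)) (at t)"
    by (auto intro!: derivative_eq_intros)
  have "(\<lambda>h. (h *\<^sub>R d) \<bullet> gradient f (y + t *\<^sub>R d)) = (*) (gradient f (y + t *\<^sub>R d) \<bullet> d)"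
    by (simp add: fun_eq_iff inner_commute)
  then show ?thesis
    using has_derivative_compose[OF line f] by (simp add: has_field_derivative_def)
qed

text \<open>On the line through \<open>y\<close> and \<open>x\<close> this is the tangent inequality
  for a convex function of one real variable, compared at \<open>0\<close> and
  \<open>1\<close>.\<close>

lemma convex_on_ge_gradient_tangent:
  fixes f :: "'a::euclidean_space \<Rightarrow> real"
  assumes "convex_on UNIV f" "f differentiable (at y)"
  shows "f y + gradient f y \<bullet> (x - y) \<le> f x"
proof -
  let ?\<phi> = "\<lambda>t. f (y + t *\<^sub>R (x - y))"
  have "convex_on UNIV ?\<phi>"
  proof (intro convex_onI)
    fix t u v :: real assume "0 < t" "t < 1"
    moreover have "y + ((1 - t) *\<^sub>R u + t *\<^sub>R v) *\<^sub>R (x - y)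
        = (1 - t) *\<^sub>R (y + u *\<^sub>R (x - y)) + t *\<^sub>R (y + v *\<^sub>R (x - y))"
      by (simp add: algebra_simps)
    ultimately show "?\<phi> ((1 - t) *\<^sub>R u + t *\<^sub>R v) \<le> (1 - t) * ?\<phi> u + t * ?\<phi> v"
      using convex_onD[OF assms(1), of t] by simp
  qed simp
  moreover have "(?\<phi> has_real_derivative gradient f y \<bullet> (x - y)) (at 0)"
    using has_real_derivative_along_line[of f y 0 "x - y"] assms(2) by simp
  ultimately have "?\<phi> 1 - ?\<phi> 0 \<ge> gradient f y \<bullet> (x - y) * (1 - 0)"
    by (intro convex_on_imp_above_tangent[of UNIV]) auto
  then show ?thesis by simp
qed

lemma smooth_convex_ge_tangent:
  assumes "f \<in> smooth_convex L"
  shows "f y + gradient f y \<bullet> (x - y) \<le> f x"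
  using assms by (intro convex_on_ge_gradient_tangent) (auto simp: smooth_convex_def)

lemma smooth_convex_descent:
  fixes f :: "'a::euclidean_space \<Rightarrow> real"
  assumes "f \<in> smooth_convex L"
  shows "f x \<le> f y + gradient f y \<bullet> (x - y) + L / 2 * (norm (x - y))\<^sup>2"
proof -
  define d where "d = x - y"
  \<comment> \<open>\<open>f\<close> along the segment minus the nonconstant part of the claimed
    upper bound; the claim becomes \<open>?\<phi> 1 \<le> ?\<phi> 0\<close>, and the Lipschitz
    gradient makes the derivative nonpositive.\<close>
  let ?\<phi> = "\<lambda>t. f (y + t *\<^sub>R d) - t * (gradient f y \<bullet> d) - L / 2 * t\<^sup>2 * (norm d)\<^sup>2"
  have diff: "f differentiable (at z)" for z
    using assms by (simp add: smooth_convex_def)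
  have lip: "norm (gradient f u - gradient f v) \<le> L * norm (u - v)" for u v
    using assms lipschitz_onD[of L UNIV "gradient f" u v]
    by (auto simp: smooth_convex_def dist_norm)
  have "?\<phi> 0 \<ge> ?\<phi> 1"
  proof (rule DERIV_nonpos_imp_nonincreasing[of 0 1 ?\<phi>])
    fix t :: real assume "0 \<le> t" "t \<le> 1"
    let ?D = "gradient f (y + t *\<^sub>R d) \<bullet> d - gradient f y \<bullet> d - L * t * (norm d)\<^sup>2"
    have "(?\<phi> has_real_derivative ?D) (at t)"
      by (auto intro!: derivative_eq_intros has_real_derivative_along_line diff)
    moreover have "(gradient f (y + t *\<^sub>R d) - gradient f y) \<bullet> d \<le> L * t * (norm d)\<^sup>2"
    proof -
      have "(gradient f (y + t *\<^sub>R d) - gradient f y) \<bullet> d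
          \<le> norm (gradient f (y + t *\<^sub>R d) - gradient f y) * norm d"
        by (rule norm_cauchy_schwarz)
      also have "\<dots> \<le> (L * norm (t *\<^sub>R d)) * norm d"
        using lip[of "y + t *\<^sub>R d" y] by (intro mult_right_mono) auto
      finally show ?thesis
        using \<open>0 \<le> t\<close> by (simp add: power2_eq_square mult.assoc)
    qed
    ultimately show "\<exists>D. (?\<phi> has_real_derivative D) (at t) \<and> D \<le> 0"
      by (intro exI[of _ ?D]) (simp add: inner_diff_left)
  qed simp
  then show ?thesis by (simp add: d_def)
qed

section \<open>The conjugate's domain and its minimum-norm point\<close>

lemma conjugate_upper:
  "ereal (p \<bullet> x - f x) \<le> conjugate f p"
  unfolding conjugate_def by (rule SUP_upper) simp

lemma conj_dom_iff:
  "p \<in> conj_dom f \<longleftrightarrow> (\<exists>M. \<forall>x. p \<bullet> x - f x \<le> M)"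
proof
  assume "p \<in> conj_dom f"
  then obtain M where "conjugate f p = ereal M"
    using conjugate_upper[of p 0 f] by (cases "conjugate f p") (auto simp: conj_dom_def)
  then show "\<exists>M. \<forall>x. p \<bullet> x - f x \<le> M"
    using conjugate_upper[of p _ f] by auto
next
  assume "\<exists>M. \<forall>x. p \<bullet> x - f x \<le> M"
  then obtain M where "\<forall>x. p \<bullet> x - f x \<le> M" ..
  then have "conjugate f p \<le> ereal M"
    unfolding conjugate_def by (auto intro!: SUP_least)
  then show "p \<in> conj_dom f"
    by (auto simp: conj_dom_def)
qed

lemma convex_conj_dom: "convex (conj_dom f)"
proof (rule convexI)
  fix p q and u v :: real
  assume "p \<in> conj_dom f" "q \<in> conj_dom f" and uv: "0 \<le> u" "0 \<le> v" "u + v = 1"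
  then obtain M N where M: "p \<bullet> x - f x \<le> M" and N: "q \<bullet> x - f x \<le> N" for x
    unfolding conj_dom_iff by blast
  have "(u *\<^sub>R p + v *\<^sub>R q) \<bullet> x - f x \<le> u * M + v * N" for x
  proof -
    have "u * f x + v * f x = f x"
      using uv(3) by (simp flip: distrib_right)
    then have "(u *\<^sub>R p + v *\<^sub>R q) \<bullet> x - f x = u * (p \<bullet> x - f x) + v * (q \<bullet> x - f x)"
      by (simp add: inner_add_left algebra_simps)
    also have "\<dots> \<le> u * M + v * N"
      using uv M N by (intro add_mono mult_left_mono)
    finally show ?thesis .
  qed
  then show "u *\<^sub>R p + v *\<^sub>R q \<in> conj_dom f"
    unfolding conj_dom_iff by blast
qed

text \<open>By the tangent inequality, the supremum defining the conjugate at
  \<open>gradient f y\<close> is attained at \<open>y\<close>.\<close>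

lemma gradient_in_conj_dom:
  assumes "f \<in> smooth_convex L"
  shows "gradient f y \<in> conj_dom f"
proof -
  have "gradient f y \<bullet> x - f x \<le> gradient f y \<bullet> y - f y" for x
    using smooth_convex_ge_tangent[OF assms, of y x] by (simp add: inner_diff_right)
  then show ?thesis
    unfolding conj_dom_iff by blast
qed

text \<open>First-order optimality: were the inner product negative, a short move from
  \<open>p\<close> towards \<open>q\<close> would stay in \<open>S\<close> and shrink the
  norm.\<close>

lemma min_norm_point_inner_nonneg:
  assumes "convex S" "min_norm_point S p" "q \<in> S"
  shows "(q - p) \<bullet> p \<ge> 0"
proof (rule ccontr)
  assume "\<not> ?thesis"
  then have "(0 - p) \<bullet> (q - p) > 0"
    by (simp add: inner_commute)
  then obtain u where u: "u > 0" "u \<le> 1" "dist (p + u *\<^sub>R (q - p)) 0 < dist p 0"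
    using closer_point_lemma[of 0 p q] by (auto simp: dist_commute)
  have "p + u *\<^sub>R (q - p) = (1 - u) *\<^sub>R p + u *\<^sub>R q"
    by (simp add: algebra_simps)
  also have "\<dots> \<in> S"
    using assms u by (intro convexD) (auto simp: min_norm_point_def)
  finally show False
    using assms(2) u(3) by (auto simp: min_norm_point_def)
qed

section \<open>The dual divergence as a real function\<close>

definition ddiv :: "('a::euclidean_space \<Rightarrow> real) \<Rightarrow> 'a \<Rightarrow> 'a \<Rightarrow> real" where
  "ddiv f x p = real_of_ereal (dual_divergence f x p)"

context
  fixes f :: "'a::euclidean_space \<Rightarrow> real" and p :: 'a
  assumes p: "p \<in> conj_dom f"
begin

lemma ddiv_eq: "ddiv f x p = f x + real_of_ereal (conjugate f p) - p \<bullet> x"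
  using p conjugate_upper[of p 0 f]
  by (cases "conjugate f p") (auto simp: ddiv_def dual_divergence_def conj_dom_def)

lemma ddiv_nonneg: "ddiv f x p \<ge> 0"
  using p conjugate_upper[of p x f] unfolding ddiv_eq
  by (cases "conjugate f p") (auto simp: conj_dom_def)

context
  fixes L :: real
  assumes f: "f \<in> smooth_convex L"
begin

text \<open>As a function of its point the divergence is \<open>f\<close> plus an affine function,
  hence convex with gradient \<open>gradient f y - p\<close>.\<close>

lemma ddiv_ge_tangent: "ddiv f y p + (gradient f y - p) \<bullet> (x - y) \<le> ddiv f x p"
  using smooth_convex_ge_tangent[OF f, of y x]
  by (simp add: ddiv_eq inner_diff_left inner_diff_right)

lemma ddiv_gradient_step:
  assumes s: "0 \<le> s" "L * s \<le> 1"
  shows "ddiv f (y - s *\<^sub>R (gradient f y - p)) p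
    \<le> ddiv f y p - s / 2 * (norm (gradient f y - p))\<^sup>2"
proof -
  let ?d = "gradient f y - p"
  have "f (y - s *\<^sub>R ?d) \<le> f y - s * (gradient f y \<bullet> ?d) + L / 2 * (norm (s *\<^sub>R ?d))\<^sup>2"
    using smooth_convex_descent[OF f, of "y - s *\<^sub>R ?d" y] by simp
  then have "ddiv f (y - s *\<^sub>R ?d) p
      \<le> ddiv f y p - s * (?d \<bullet> ?d) + L / 2 * (norm (s *\<^sub>R ?d))\<^sup>2"
    by (simp add: ddiv_eq inner_diff_left inner_diff_right algebra_simps)
  \<comment> \<open>The quadratic term is rewritten with a factor \<open>L * s\<close>, so that
    \<open>L * s \<le> 1\<close> costs at most half of the linear gain.\<close>
  also have "\<dots> = ddiv f y p - s * (norm ?d)\<^sup>2 + s / 2 * (L * s) * (norm ?d)\<^sup>2"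
    by (simp add: power_mult_distrib power2_norm_eq_inner) (simp add: power2_eq_square)
  also have "\<dots> \<le> ddiv f y p - s * (norm ?d)\<^sup>2 + s / 2 * 1 * (norm ?d)\<^sup>2"
    using s by (intro add_left_mono mult_right_mono mult_left_mono) auto
  finally show ?thesis by simp
qed

text \<open>Otherwise a step of length \<open>1 / L\<close> would push the nonnegative divergence
  below zero. This settles the case in which \<open>C_tilde\<close> contains
  \<open>0 / 0\<close>.\<close>

lemma gradient_eq_if_ddiv_0:
  assumes "L > 0" "ddiv f y p = 0"
  shows "gradient f y = p"
proof -
  have "0 \<le> - (1 / L / 2 * (norm (gradient f y - p))\<^sup>2)"
    using ddiv_gradient_step[of "1 / L" y] ddiv_nonneg[of "y - (1 / L) *\<^sub>R (gradient f y - p)"] assms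
    by simp
  then show ?thesis
    using assms(1) by (simp add: divide_le_0_iff mult_le_0_iff)
qed

text \<open>
  The method moves along \<open>- gradient f y\<close>, whereas descent of the divergence is only available along
  \<open>- (gradient f y - p)\<close>. The difference is a move along \<open>- p\<close>, which does not increase the divergence
  because \<open>p\<close> has minimal norm in the conjugate's domain.
\<close>

lemma ddiv_step_min_norm:
  assumes "min_norm_point (conj_dom f) p" "0 \<le> s" "L * s \<le> 1"
  shows "ddiv f (y - s *\<^sub>R gradient f y) p \<le> ddiv f y p - s / 2 * (norm (gradient f y - p))\<^sup>2"
proof -
  let ?u = "y - s *\<^sub>R (gradient f y - p)" and ?v = "y - s *\<^sub>R gradient f y"
  have "(gradient f ?v - p) \<bullet> p \<ge> 0"
    by (rule min_norm_point_inner_nonneg[OF convex_conj_dom assms(1) gradient_in_conj_dom[OF f]])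
  moreover have "?u - ?v = s *\<^sub>R p"
    by (simp add: algebra_simps)
  ultimately have "ddiv f ?v p \<le> ddiv f ?u p"
    using ddiv_ge_tangent[of ?v ?u] assms(2) by (simp add: mult_nonneg_nonneg order_trans[rotated])
  then show ?thesis
    using ddiv_gradient_step[OF assms(2,3), of y] by simp
qed

end

end

section \<open>The Lyapunov function\<close>

locale accelerated_gradient =
  fixes f :: "'a::euclidean_space \<Rightarrow> real" and x0 :: 'a and L :: real and A :: "nat \<Rightarrow> real"
  assumes L_pos: "L > 0"
    and smooth: "f \<in> smooth_convex L"
    and step: "step_size_condition L A"
begin

abbreviation "a \<equiv> fdiff A"
abbreviation "x \<equiv> agm_x f A x0"
abbreviation "y \<equiv> agm_y f A x0"
abbreviation "g k \<equiv> gradient f (y k)"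

definition z :: "nat \<Rightarrow> 'a" where
  "z k = x0 - (1 / 4) *\<^sub>R (\<Sum>i<k. a i *\<^sub>R g i)"

definition avg_grad :: "nat \<Rightarrow> 'a" where
  "avg_grad k = (1 / A k) *\<^sub>R (\<Sum>i<k. a i *\<^sub>R g i)"

text \<open>The common denominator of \<open>Q_coeff\<close>, \<open>B_tilde\<close> and
  \<open>C_tilde\<close>, with the index shifted to start at 0 for induction.\<close>

definition S :: "nat \<Rightarrow> real" where
  "S k = (\<Sum>i<k. A (Suc i) * a i)"

lemma a_pos: "a k > 0"
  and A_0: "A 0 = 0"
  and a_le: "a k \<le> 2 * sqrt (A (Suc k) / L)"
  and a_theta: "a \<in> \<Theta>(real)"
  using step by (auto simp: step_size_condition_def)

lemma a_nonneg: "a k \<ge> 0"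
  by (rule less_imp_le[OF a_pos])

lemma A_Suc: "A (Suc k) = A k + a k"
  by (simp add: fdiff_def)

lemma A_eq_sum: "A k = (\<Sum>i<k. a i)"
  by (induction k) (auto simp: A_0 A_Suc)

lemma A_nonneg: "A k \<ge> 0"
  using a_nonneg by (subst A_eq_sum, intro sum_nonneg)

lemma A_Suc_pos: "A (Suc k) > 0"
  using add_nonneg_pos[OF A_nonneg[of k] a_pos[of k]] by (simp only: A_Suc)

lemma A_pos: "k \<ge> 1 \<Longrightarrow> A k > 0"
  using A_Suc_pos[of "k - 1"] by simp

lemma S_eq: "(\<Sum>i=1..k. A i * a (i - 1)) = S k"
  unfolding S_def by (rule sum.reindex_bij_witness[of _ Suc "\<lambda>i. i - 1"]) auto

lemma sum_sqrt_eq: "(\<Sum>i=1..k. sqrt (A i) * a (i - 1)) = (\<Sum>i<k. sqrt (A (Suc i)) * a i)"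
  by (rule sum.reindex_bij_witness[of _ Suc "\<lambda>i. i - 1"]) auto

lemma S_pos:
  assumes "k \<ge> 1"
  shows "S k > 0"
  unfolding S_def
proof (rule sum_pos)
  show "{..<k} \<noteq> {}" using assms by (auto simp: lessThan_empty_iff)
qed (auto intro!: mult_pos_pos A_Suc_pos a_pos)

section \<open>The iterates and \<open>q_seq\<close> as weighted averages\<close>

lemma z_Suc: "z (Suc k) = z k - (a k / 4) *\<^sub>R g k"
  by (simp add: z_def scaleR_right_distrib)

lemma z_eq_avg_grad: "k \<ge> 1 \<Longrightarrow> z k - x0 = - (A k / 4) *\<^sub>R avg_grad k"
  using A_pos[of k] by (simp add: z_def avg_grad_def)

text \<open>Scaled by \<open>A (Suc k)\<close>, the gradient step is \<open>a k\<close> times the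
  move from \<open>z k\<close> to \<open>z (Suc k)\<close>. The premise is \<open>y_average\<close>
  at \<open>k\<close>, kept as an assumption because the induction proving \<open>y_average\<close>
  uses this lemma.\<close>

lemma x_Suc_of_y:
  assumes "A (Suc k) *\<^sub>R y k = A k *\<^sub>R x k + a k *\<^sub>R z k"
  shows "A (Suc k) *\<^sub>R x (Suc k) = A k *\<^sub>R x k + a k *\<^sub>R z (Suc k)"
proof -
  have "A (Suc k) *\<^sub>R x (Suc k) = A (Suc k) *\<^sub>R y k - ((a k)\<^sup>2 / 4) *\<^sub>R g k"
    using A_Suc_pos[of k] by (simp add: scaleR_right_diff_distrib)
  then show ?thesis
    by (simp add: assms z_Suc scaleR_right_diff_distrib power2_eq_square del: agm_x.simps)
qed

text \<open>The momentum coefficient is made for this: \<open>x_Suc_of_y\<close> turns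
  \<open>A k\<close> times \<open>x (Suc k) - x k\<close> into \<open>a k\<close> times
  \<open>z (Suc k) - x (Suc k)\<close>, so after scaling by \<open>A (k + 2)\<close> the
  extrapolation adds \<open>a (Suc k)\<close> times that last vector.\<close>

lemma y_average: "A (Suc k) *\<^sub>R y k = A k *\<^sub>R x k + a k *\<^sub>R z k"
proof (induction k)
  case 0
  show ?case by (simp add: z_def A_Suc A_0)
next
  case (Suc k)
  define u where "u = x (Suc k)"
  define w where "w = z (Suc k)"
  have "A k *\<^sub>R (u - x k) = a k *\<^sub>R (w - u)"
    using x_Suc_of_y[OF Suc] unfolding u_def[symmetric] w_def[symmetric]
    by (simp add: A_Suc algebra_simps)
  then have "(A k * a (Suc k) / a k) *\<^sub>R (u - x k) = (a (Suc k) / a k) *\<^sub>R a k *\<^sub>R (w - u)"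
    by (metis mult.commute scaleR_scaleR times_divide_eq_left)
  moreover have "A (Suc (Suc k)) *\<^sub>R y (Suc k)
      = A (Suc (Suc k)) *\<^sub>R u + (A k * a (Suc k) / a k) *\<^sub>R (u - x k)"
    using A_Suc_pos[of "Suc k"] unfolding u_def[symmetric] agm_y.simps
    by (simp add: scaleR_right_distrib)
  ultimately have "A (Suc (Suc k)) *\<^sub>R y (Suc k)
      = A (Suc (Suc k)) *\<^sub>R u + a (Suc k) *\<^sub>R (w - u)"
    using a_pos[of k] by simp
  also have "\<dots> = A (Suc k) *\<^sub>R u + a (Suc k) *\<^sub>R w"
    by (simp add: A_Suc[of "Suc k"] algebra_simps)
  finally show ?case by (simp add: u_def w_def)
qed

lemma x_average: "A (Suc k) *\<^sub>R x (Suc k) = A k *\<^sub>R x k + a k *\<^sub>R z (Suc k)"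
  by (rule x_Suc_of_y[OF y_average])

lemma x_minus_x0: "A k *\<^sub>R (x k - x0) = (\<Sum>i<k. a i *\<^sub>R (z (Suc i) - x0))"
proof (induction k)
  case (Suc k)
  have "A (Suc k) *\<^sub>R (x (Suc k) - x0) = A k *\<^sub>R (x k - x0) + a k *\<^sub>R (z (Suc k) - x0)"
    unfolding scaleR_right_diff_distrib x_average by (simp add: A_Suc algebra_simps)
  then show ?case using Suc by simp
qed (simp add: A_0)

text \<open>The factor \<open>A k\<close> of \<open>Q_coeff\<close> turns \<open>x k - x0\<close>
  into the sum of \<open>x_minus_x0\<close>, and its 4 cancels the \<open>1 / 4\<close> in
  \<open>z\<close>.\<close>

lemma q_seq_eq_average:
  assumes "k \<ge> 1"
  shows "q_seq f A x0 k = (\<Sum>i<k. (A (Suc i) * a i / S k) *\<^sub>R avg_grad (Suc i))"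
proof -
  have "q_seq f A x0 k = - (4 / S k) *\<^sub>R (A k *\<^sub>R (x k - x0))"
    unfolding q_seq_def Q_coeff_def S_eq by simp
  also have "\<dots> = (\<Sum>i<k. (A (Suc i) * a i / S k) *\<^sub>R avg_grad (Suc i))"
    unfolding x_minus_x0 by (simp add: z_eq_avg_grad scaleR_sum_right sum_negf mult_ac)
  finally show ?thesis .
qed

lemma q_weights: "k \<ge> 1 \<Longrightarrow> (\<Sum>i<k. A (Suc i) * a i / S k) = 1"
  using S_pos[of k] by (simp add: S_def flip: sum_divide_distrib)

lemma avg_grad_in_conj_dom:
  assumes "k \<ge> 1"
  shows "avg_grad k \<in> conj_dom f"
proof -
  have "avg_grad k = (\<Sum>i<k. (a i / A k) *\<^sub>R g i)"
    by (simp add: avg_grad_def scaleR_sum_right)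
  also have "\<dots> \<in> conj_dom f"
    using A_pos[OF assms]
    by (intro convex_sum convex_conj_dom gradient_in_conj_dom[OF smooth])
       (auto simp: a_nonneg A_eq_sum[symmetric] simp flip: sum_divide_distrib)
  finally show ?thesis .
qed

lemma q_seq_in_conj_dom:
  assumes "k \<ge> 1"
  shows "q_seq f A x0 k \<in> conj_dom f"
  unfolding q_seq_eq_average[OF assms]
  using q_weights[OF assms] S_pos[OF assms]
  by (intro convex_sum convex_conj_dom avg_grad_in_conj_dom) (auto simp: a_nonneg A_nonneg)

end

locale accelerated_gradient_min_norm = accelerated_gradient +
  fixes p
  assumes p_min: "min_norm_point (conj_dom f) p"
begin

abbreviation "h u \<equiv> ddiv f u p"
abbreviation "D \<equiv> ddiv f x0 p"

definition \<theta> :: "nat \<Rightarrow> real" where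
  "\<theta> k = (g k - p) \<bullet> p"

text \<open>
  The anchor drifts linearly with \<open>A k\<close> in direction \<open>- p\<close>, which accounts for the iterates
  escaping to infinity when \<open>f\<close> has no minimizer.
\<close>

definition lyap :: "nat \<Rightarrow> real" where
  "lyap k = (norm (z k - x0 + (A k / 4) *\<^sub>R p))\<^sup>2 / 2 + A k / 4 * h (x k)"

lemma p_dom: "p \<in> conj_dom f"
  using p_min by (simp add: min_norm_point_def)

lemma D_nonneg: "D \<ge> 0"
  by (rule ddiv_nonneg[OF p_dom])

lemma \<theta>_nonneg: "\<theta> k \<ge> 0"
  unfolding \<theta>_def
  by (rule min_norm_point_inner_nonneg[OF convex_conj_dom p_min gradient_in_conj_dom[OF smooth]])

text \<open>The decrease of \<open>h\<close> along the gradient step cancels the squared increment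
  of \<open>z\<close>: both are \<open>(a k)\<^sup>2 / 32 * (norm v)\<^sup>2\<close>. The remaining
  cross term \<open>v \<bullet> W\<close> is absorbed by the tangent inequalities at
  \<open>y k\<close> towards \<open>x0\<close> and \<open>x k\<close>.\<close>

lemma lyap_Suc_le: "lyap (Suc k) \<le> lyap k + a k / 4 * D - a k * A k / 16 * \<theta> k"
proof -
  define s where "s = (a k)\<^sup>2 / (4 * A (Suc k))"
  define W where "W = z k - x0 + (A k / 4) *\<^sub>R p"
  define v where "v = g k - p"
  have A': "A (Suc k) > 0" by (rule A_Suc_pos)
  \<comment> \<open>The step-size condition, squared, says exactly that the step length satisfies
    \<open>L * s \<le> 1\<close>.\<close>
  have "(a k)\<^sup>2 \<le> (2 * sqrt (A (Suc k) / L))\<^sup>2"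
    using a_le[of k] a_pos[of k] by (intro power_mono) auto
  then have "L * (a k)\<^sup>2 \<le> 4 * A (Suc k)"
    using L_pos A' by (simp add: power_mult_distrib field_simps)
  then have s: "0 \<le> s" "L * s \<le> 1"
    using A' by (auto simp: s_def field_simps)
  have "x (Suc k) = y k - s *\<^sub>R g k"
    by (simp add: s_def)
  then have "h (x (Suc k)) \<le> h (y k) - s / 2 * (norm v)\<^sup>2"
    using ddiv_step_min_norm[OF p_dom smooth p_min s, of "y k"] by (simp only: v_def)
  then have "A (Suc k) / 4 * h (x (Suc k)) \<le> A (Suc k) / 4 * (h (y k) - s / 2 * (norm v)\<^sup>2)"
    using A' by (intro mult_left_mono) auto
  also have "\<dots> = A (Suc k) / 4 * h (y k) - (a k)\<^sup>2 / 32 * (norm v)\<^sup>2"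
    using A' by (simp add: s_def field_simps)
  finally have hx: "A (Suc k) / 4 * h (x (Suc k))
      \<le> A (Suc k) / 4 * h (y k) - (a k)\<^sup>2 / 32 * (norm v)\<^sup>2" .
  \<comment> \<open>The drift of the anchor makes the increment depend on \<open>g k\<close> only
    through \<open>v\<close>.\<close>
  have "z (Suc k) - x0 + (A (Suc k) / 4) *\<^sub>R p = W - (a k / 4) *\<^sub>R v"
    by (simp add: z_Suc A_Suc W_def v_def algebra_simps add_divide_distrib)
  moreover have "(norm (W - (a k / 4) *\<^sub>R v))\<^sup>2
      = (norm W)\<^sup>2 - a k / 2 * (v \<bullet> W) + (a k)\<^sup>2 / 16 * (norm v)\<^sup>2"
    by (simp add: power2_norm_eq_inner inner_diff_left inner_diff_right inner_commute)
       (simp add: power2_eq_square algebra_simps)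
  ultimately have W': "(norm (z (Suc k) - x0 + (A (Suc k) / 4) *\<^sub>R p))\<^sup>2 / 2
      = (norm W)\<^sup>2 / 2 - a k / 4 * (v \<bullet> W) + (a k)\<^sup>2 / 32 * (norm v)\<^sup>2"
    by (simp only:) (simp add: field_simps)
  \<comment> \<open>\<open>y_average\<close> rearranged: it splits the cross term into the two
    displacements used by the tangent inequalities, while the \<open>p\<close> part of
    \<open>W\<close> yields \<open>\<theta> k\<close>.\<close>
  have "a k *\<^sub>R (z k - x0) = a k *\<^sub>R (y k - x0) + A k *\<^sub>R (y k - x k)"
    using y_average[of k] by (simp add: A_Suc algebra_simps)
  then have "v \<bullet> (a k *\<^sub>R (z k - x0)) = v \<bullet> (a k *\<^sub>R (y k - x0) + A k *\<^sub>R (y k - x k))"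
    by (rule arg_cong)
  then have "a k * (v \<bullet> (z k - x0)) = a k * (v \<bullet> (y k - x0)) + A k * (v \<bullet> (y k - x k))"
    by (simp add: inner_add_right)
  then have vW: "a k * (v \<bullet> W)
      = a k * (v \<bullet> (y k - x0)) + A k * (v \<bullet> (y k - x k)) + a k * A k / 4 * \<theta> k"
    by (simp add: W_def inner_add_right \<theta>_def v_def[symmetric] algebra_simps)
  have "a k * (h (y k) - v \<bullet> (y k - x0)) \<le> a k * D"
    using ddiv_ge_tangent[OF p_dom smooth, of "y k" x0] a_pos[of k]
    by (intro mult_left_mono) (auto simp: v_def inner_diff_right)
  moreover have "A k * (h (y k) - v \<bullet> (y k - x k)) \<le> A k * h (x k)"
    using ddiv_ge_tangent[OF p_dom smooth, of "y k" "x k"] A_nonneg[of k]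
    by (intro mult_left_mono) (auto simp: v_def inner_diff_right)
  ultimately have tang: "A (Suc k) * h (y k) - a k * (v \<bullet> W)
      \<le> a k * D + A k * h (x k) - a k * A k / 4 * \<theta> k"
    unfolding vW by (simp add: A_Suc algebra_simps)
  have "lyap (Suc k) \<le> (norm W)\<^sup>2 / 2 - a k / 4 * (v \<bullet> W) + A (Suc k) / 4 * h (y k)"
    unfolding lyap_def using hx W' by linarith
  also have "\<dots> \<le> lyap k + a k / 4 * D - a k * A k / 16 * \<theta> k"
    using tang by (simp add: lyap_def W_def[symmetric])
  finally show ?thesis .
qed

text \<open>Telescoping from \<open>lyap 0 = 0\<close>, since the increments \<open>a i\<close> sum
  to \<open>A k\<close>.\<close>

lemma lyap_le: "lyap k + (\<Sum>i<k. a i * A i * \<theta> i) / 16 \<le> A k / 4 * D"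
proof (induction k)
  case 0
  show ?case by (simp add: lyap_def z_def A_0)
next
  case (Suc k)
  show ?case
    using Suc lyap_Suc_le[of k] by (simp add: A_Suc algebra_simps add_divide_distrib)
qed

section \<open>Bounds drawn from the Lyapunov function\<close>

lemma sum_\<theta>_le: "(\<Sum>i<k. a i * A i * \<theta> i) \<le> 4 * A k * D"
proof -
  have "lyap k \<ge> 0"
    using ddiv_nonneg[OF p_dom] A_nonneg by (simp add: lyap_def)
  then show ?thesis using lyap_le[of k] by simp
qed

text \<open>Only the squared norm in \<open>lyap\<close> is kept. The factor
  \<open>sqrt (A k)\<close> stays on the left because the weights of \<open>q_seq\<close> supply
  it.\<close>

lemma norm_avg_grad_minus_p_le:
  assumes "k \<ge> 1"
  shows "sqrt (A k) * norm (avg_grad k - p) \<le> sqrt (8 * D)"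
proof -
  have Ak: "A k > 0" by (rule A_pos[OF assms])
  have "z k - x0 + (A k / 4) *\<^sub>R p = - (A k / 4) *\<^sub>R (avg_grad k - p)"
    by (simp add: z_eq_avg_grad[OF assms] algebra_simps)
  then have "(norm (z k - x0 + (A k / 4) *\<^sub>R p))\<^sup>2 = (A k)\<^sup>2 / 16 * (norm (avg_grad k - p))\<^sup>2"
    by (simp add: power_mult_distrib power_divide)
  moreover have "(norm (z k - x0 + (A k / 4) *\<^sub>R p))\<^sup>2 / 2 \<le> A k / 4 * D"
  proof -
    have "(\<Sum>i<k. a i * A i * \<theta> i) \<ge> 0"
      by (intro sum_nonneg mult_nonneg_nonneg a_nonneg A_nonneg \<theta>_nonneg)
    moreover have "A k / 4 * h (x k) \<ge> 0"
      using Ak ddiv_nonneg[OF p_dom] by simp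
    ultimately show ?thesis
      using lyap_le[of k] unfolding lyap_def by linarith
  qed
  ultimately have "A k * (A k * (norm (avg_grad k - p))\<^sup>2) \<le> A k * (8 * D)"
    by (simp add: power2_eq_square)
  then have "A k * (norm (avg_grad k - p))\<^sup>2 \<le> 8 * D"
    using Ak by simp
  then have "sqrt (A k * (norm (avg_grad k - p))\<^sup>2) \<le> sqrt (8 * D)"
    by (rule real_sqrt_le_mono)
  then show ?thesis by (simp add: real_sqrt_mult)
qed

lemma q_seq_minus_p:
  assumes "k \<ge> 1"
  shows "q_seq f A x0 k - p = (\<Sum>i<k. (A (Suc i) * a i / S k) *\<^sub>R (avg_grad (Suc i) - p))"
proof -
  have "(\<Sum>i<k. (A (Suc i) * a i / S k) *\<^sub>R p) = p"
    using q_weights[OF assms] by (simp flip: scaleR_sum_left)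
  then show ?thesis
    by (simp add: q_seq_eq_average[OF assms] scaleR_right_diff_distrib sum_subtractf)
qed

lemma norm_q_seq_minus_p_le:
  assumes "k \<ge> 1"
  shows "(norm (q_seq f A x0 k - p))\<^sup>2 \<le> B_tilde A k * D"
proof -
  let ?R = "\<Sum>i<k. sqrt (A (Suc i)) * a i"
  have "norm (q_seq f A x0 k - p)
      \<le> (\<Sum>i<k. norm ((A (Suc i) * a i / S k) *\<^sub>R (avg_grad (Suc i) - p)))"
    unfolding q_seq_minus_p[OF assms] by (rule norm_sum)
  also have "\<dots> = (\<Sum>i<k. sqrt (A (Suc i)) * a i / S k
      * (sqrt (A (Suc i)) * norm (avg_grad (Suc i) - p)))"
  proof (intro sum.cong refl)
    fix i
    \<comment> \<open>One square root pairs with the norm bound; the other remains to form the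
      numerator of \<open>B_tilde\<close>.\<close>
    have "A (Suc i) = sqrt (A (Suc i)) * sqrt (A (Suc i))"
      using A_nonneg by simp
    then show "norm ((A (Suc i) * a i / S k) *\<^sub>R (avg_grad (Suc i) - p))
        = sqrt (A (Suc i)) * a i / S k * (sqrt (A (Suc i)) * norm (avg_grad (Suc i) - p))"
      using S_pos[OF assms] a_pos[of i] A_nonneg[of "Suc i"] by simp
  qed
  also have "\<dots> \<le> (\<Sum>i<k. sqrt (A (Suc i)) * a i / S k * sqrt (8 * D))"
    using S_pos[OF assms]
    by (intro sum_mono mult_left_mono norm_avg_grad_minus_p_le) (auto simp: a_nonneg A_nonneg)
  also have "\<dots> = ?R / S k * sqrt (8 * D)"
    by (simp add: sum_divide_distrib sum_distrib_right)
  finally have "(norm (q_seq f A x0 k - p))\<^sup>2 \<le> (?R / S k * sqrt (8 * D))\<^sup>2"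
    by (intro power_mono) auto
  also have "\<dots> = B_tilde A k * D"
    unfolding B_tilde_def sum_sqrt_eq S_eq using D_nonneg by (simp add: power_mult_distrib power_divide)
  finally show ?thesis .
qed

text \<open>Exchange of summation: \<open>a i * \<theta> i\<close> occurs for each \<open>j\<close>
  from \<open>i\<close> to \<open>k - 1\<close>, and those \<open>a j\<close> sum to
  \<open>A k - A i\<close>.\<close>

lemma sum_\<theta>_diff: "(\<Sum>j<k. a j * (\<Sum>i<Suc j. a i * \<theta> i))
    = A k * (\<Sum>i<k. a i * \<theta> i) - (\<Sum>i<k. a i * A i * \<theta> i)"
  by (induction k) (auto simp: A_0 A_Suc algebra_simps)

text \<open>Only sums weighted by \<open>A i\<close> are controlled by
  \<open>sum_\<theta>_le\<close>; Abel summation removes that weight. Index 0 has weight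
  \<open>A 0 = 0\<close>, so its term \<open>A 1 * \<theta> 0\<close> is split off.\<close>

lemma sum_sum_\<theta>_le:
  assumes "k \<ge> 1"
  shows "(\<Sum>j<k. a j * (\<Sum>i<Suc j. a i * \<theta> i))
    \<le> A k * (A 1 * \<theta> 0 + 4 * D * (\<Sum>i=1..<k. a i / A i))"
proof -
  define T where "T k = (\<Sum>i<k. a i * A i * \<theta> i)" for k
  \<comment> \<open>The left side is that of \<open>sum_\<theta>_diff\<close> divided by
    \<open>A k\<close>; the subtracted quotient also takes up the boundary term of the Abel
    summation.\<close>
  have "(\<Sum>i<k. a i * \<theta> i) - T k / A k \<le> A 1 * \<theta> 0 + 4 * D * (\<Sum>i=1..<k. a i / A i)"
    using assms
  proof (induction k rule: dec_induct)
    case base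
    show ?case by (simp add: T_def A_Suc A_0)
  next
    case (step k)
    have Ak: "A k > 0" using A_pos step by simp
    have "a k * \<theta> k = (T (Suc k) - T k) / A k"
      using Ak by (simp add: T_def)
    moreover have "T (Suc k) / A k - T (Suc k) / A (Suc k) \<le> 4 * D * (a k / A k)"
    proof -
      have "T (Suc k) / A k - T (Suc k) / A (Suc k) = T (Suc k) / A (Suc k) * (a k / A k)"
        using Ak A_Suc_pos[of k] by (simp add: A_Suc field_simps)
      also have "\<dots> \<le> 4 * D * (a k / A k)"
        using sum_\<theta>_le[of "Suc k"] A_Suc_pos[of k] a_pos[of k] Ak
        by (intro mult_right_mono) (auto simp: T_def divide_le_eq mult_ac)
      finally show ?thesis .
    qed
    ultimately show ?case
      using step by (simp add: diff_divide_distrib distrib_left)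
  qed
  then have "A k * ((\<Sum>i<k. a i * \<theta> i) - T k / A k)
      \<le> A k * (A 1 * \<theta> 0 + 4 * D * (\<Sum>i=1..<k. a i / A i))"
    using A_nonneg by (intro mult_left_mono)
  then show ?thesis
    using A_pos[OF assms] unfolding sum_\<theta>_diff T_def by (simp add: right_diff_distrib)
qed

lemma inner_q_seq_minus_p_le:
  assumes "k \<ge> 1"
  shows "(q_seq f A x0 k - p) \<bullet> p \<le> C_tilde f A x0 p k * D"
proof -
  \<comment> \<open>The weight \<open>A (Suc j)\<close> cancels the normalisation of
    \<open>avg_grad\<close>, leaving a partial sum.\<close>
  have avg: "A (Suc j) * ((avg_grad (Suc j) - p) \<bullet> p) = (\<Sum>i<Suc j. a i * \<theta> i)" for j
  proof -
    have "A (Suc j) *\<^sub>R (avg_grad (Suc j) - p) = (\<Sum>i<Suc j. a i *\<^sub>R (g i - p))"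
      using A_Suc_pos[of j]
      by (simp add: avg_grad_def scaleR_right_diff_distrib sum_subtractf
          A_eq_sum[of "Suc j"] scaleR_sum_left del: sum.lessThan_Suc)
    then have "(A (Suc j) *\<^sub>R (avg_grad (Suc j) - p)) \<bullet> p = (\<Sum>i<Suc j. a i *\<^sub>R (g i - p)) \<bullet> p"
      by (rule arg_cong)
    then show ?thesis
      by (simp add: inner_sum_left \<theta>_def del: sum.lessThan_Suc)
  qed
  have "(q_seq f A x0 k - p) \<bullet> p
      = (\<Sum>j<k. a j / S k * (A (Suc j) * ((avg_grad (Suc j) - p) \<bullet> p)))"
    by (simp add: q_seq_minus_p[OF assms] inner_sum_left mult_ac)
  also have "\<dots> = (\<Sum>j<k. a j * (\<Sum>i<Suc j. a i * \<theta> i)) / S k"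
    unfolding avg by (simp add: sum_divide_distrib del: sum.lessThan_Suc)
  also have "\<dots> \<le> A k * (A 1 * \<theta> 0 + 4 * D * (\<Sum>i=1..<k. a i / A i)) / S k"
    using sum_sum_\<theta>_le[OF assms] S_pos[OF assms] by (intro divide_right_mono) auto
  also have "\<dots> = C_tilde f A x0 p k * D"
  \<comment> \<open>If \<open>D = 0\<close>, the quotient by \<open>D\<close> in
    \<open>C_tilde\<close> cannot be cancelled; but then \<open>gradient f x0 = p\<close>, so
    \<open>\<theta> 0 = 0\<close> and both sides vanish.\<close>
  proof (cases "D = 0")
    case True
    then have "\<theta> 0 = 0"
      using gradient_eq_if_ddiv_0[OF p_dom smooth L_pos] by (simp add: \<theta>_def)
    then show ?thesis using True by simp
  next
    case False
    then show ?thesis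
      using S_pos[OF assms] unfolding C_tilde_def S_eq ddiv_def[symmetric] by (simp add: \<theta>_def field_simps)
  qed
  finally show ?thesis .
qed

text \<open>Expanding the square around \<open>p\<close> gives the squared distance plus twice the
  inner product with \<open>p\<close>, hence the form of \<open>C_tilde'\<close>.\<close>

lemma norm_q_seq_le:
  assumes "k \<ge> 1"
  shows "(norm (q_seq f A x0 k))\<^sup>2 - (norm p)\<^sup>2
    \<le> C_tilde' f A x0 p k * D + (C_tilde f A x0 p k)\<^sup>2 * D\<^sup>2 / (norm p)\<^sup>2"
proof -
  let ?q = "q_seq f A x0 k"
  have "(norm ?q)\<^sup>2 - (norm p)\<^sup>2 = (norm (?q - p))\<^sup>2 + 2 * ((?q - p) \<bullet> p)"
    by (simp add: power2_norm_eq_inner inner_diff_left inner_diff_right inner_commute)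
  also have "\<dots> \<le> C_tilde' f A x0 p k * D"
    using norm_q_seq_minus_p_le[OF assms] inner_q_seq_minus_p_le[OF assms]
    by (simp add: C_tilde'_def distrib_right)
  also have "\<dots> \<le> C_tilde' f A x0 p k * D + (C_tilde f A x0 p k)\<^sup>2 * D\<^sup>2 / (norm p)\<^sup>2"
    by simp
  finally show ?thesis .
qed

end

section \<open>Growth rates\<close>

text \<open>The finitely many indices at which the asymptotic bound may fail are absorbed into the
  constant, using \<open>v > 0\<close>.\<close>

lemma bigo_imp_bounded:
  fixes u v :: "nat \<Rightarrow> real"
  assumes "u \<in> O(v)" "\<And>k. v k > 0"
  obtains C where "C > 0" "\<And>k. \<bar>u k\<bar> \<le> C * v k"
proof -
  obtain c where c: "c > 0" "eventually (\<lambda>k. norm (u k) \<le> c * norm (v k)) at_top"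
    using assms(1) by (rule landau_o.bigE)
  then obtain N where N: "\<And>k. k \<ge> N \<Longrightarrow> \<bar>u k\<bar> \<le> c * v k"
    using assms(2) by (auto simp: eventually_at_top_linorder less_imp_le)
  define s where "s = (\<Sum>k<N. \<bar>u k\<bar> / v k)"
  have s: "s \<ge> 0"
    unfolding s_def using assms(2) by (intro sum_nonneg) (simp add: less_imp_le)
  have "\<bar>u k\<bar> \<le> (c + s) * v k" for k
  proof (cases "k < N")
    case True
    have "\<bar>u k\<bar> / v k \<le> s"
      unfolding s_def using True assms(2) by (intro member_le_sum) (auto simp: less_imp_le)
    then have "\<bar>u k\<bar> \<le> s * v k"
      using assms(2)[of k] by (simp add: divide_le_eq)
    also have "\<dots> \<le> (c + s) * v k"
      using assms(2)[of k] c(1) by (intro mult_right_mono) auto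
    finally show ?thesis .
  next
    case False
    then have "\<bar>u k\<bar> \<le> c * v k" using N by simp
    also have "\<dots> \<le> (c + s) * v k"
      using assms(2)[of k] s by (intro mult_right_mono) auto
    finally show ?thesis .
  qed
  with c(1) s show ?thesis by (intro that[of "c + s"]) auto
qed

text \<open>Bounds at every index feed the inductions below. They use \<open>Suc k\<close> because
  \<open>u 0 > 0\<close> cannot be bounded by a multiple of \<open>real 0\<close>.\<close>

lemma bigtheta_real_bounds:
  fixes u :: "nat \<Rightarrow> real"
  assumes "u \<in> \<Theta>(real)" "\<And>k. u k > 0"
  obtains c C where "c > 0" "C > 0"
    "\<And>k. c * real (Suc k) \<le> u k" "\<And>k. u k \<le> C * real (Suc k)"
proof -
  have Suc: "(\<lambda>k. real (Suc k)) \<in> \<Theta>(real)"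
    by real_asymp
  have "u \<in> O(\<lambda>k. real (Suc k))"
    using assms(1) Suc by (meson bigthetaD1 bigtheta_sym landau_o.big_trans)
  then obtain C where C: "C > 0" "\<And>k. \<bar>u k\<bar> \<le> C * real (Suc k)"
    by (rule bigo_imp_bounded) auto
  have "(\<lambda>k. real (Suc k)) \<in> O(u)"
    using assms(1) Suc by (meson bigthetaD1 bigtheta_sym landau_o.big_trans)
  then obtain c where c: "c > 0" "\<And>k. \<bar>real (Suc k)\<bar> \<le> c * u k"
    using bigo_imp_bounded[of _ u, OF _ assms(2)] by blast
  show ?thesis
  proof (rule that[of "1 / c" C])
    fix k
    show "1 / c * real (Suc k) \<le> u k"
      using c(2)[of k] c(1) by (simp add: divide_le_eq mult.commute)
    show "u k \<le> C * real (Suc k)"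
      using C(2)[of k] by simp
  qed (use c C in auto)
qed

lemma sum_inverse_bigo_ln: "(\<lambda>k. \<Sum>i=1..<k. 1 / real i) \<in> O(\<lambda>k. ln (real k))"
proof -
  have "(\<Sum>i=1..<k. 1 / real i) \<le> 1 + ln (real k)" if "k \<ge> 1" for k
  proof -
    have "(\<Sum>i=1..<k. 1 / real i) \<le> harm k"
      unfolding harm_def inverse_eq_divide by (intro sum_mono2) auto
    \<comment> \<open>The harmonic sum minus the logarithm decreases, so its value at 1 bounds
      it.\<close>
    also have "harm k - ln (real k) \<le> harm 1 - ln (real 1)"
      using decseqD[OF decseq_harm_diff_ln, of 0 "k - 1"] that by simp
    then have "harm k \<le> 1 + ln (real k)"
      by (simp add: harm_def)
    finally show ?thesis .
  qed
  then have "eventually (\<lambda>k. norm (\<Sum>i=1..<k. 1 / real i) \<le> 1 * norm (1 + ln (real k))) at_top"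
    by (intro eventually_mono[OF eventually_ge_at_top[of 1]]) (auto simp: sum_nonneg)
  then have "(\<lambda>k. \<Sum>i=1..<k. 1 / real i) \<in> O(\<lambda>k. 1 + ln (real k))"
    by (rule bigoI)
  also have "(\<lambda>k. 1 + ln (real k)) \<in> O(\<lambda>k. ln (real k))"
    by real_asymp
  finally show ?thesis .
qed

section \<open>Asymptotics of the step sizes and of the bounds\<close>

context accelerated_gradient
begin

lemma A_le:
  assumes "\<And>k. a k \<le> C * real (Suc k)" "C > 0"
  shows "A k \<le> C * (real k)\<^sup>2"
proof (induction k)
  case (Suc k)
  have "A (Suc k) \<le> C * (real k)\<^sup>2 + C * real (Suc k)"
    using Suc assms(1)[of k] by (simp add: A_Suc)
  also have "\<dots> = C * ((real k)\<^sup>2 + real k + 1)"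
    by (simp add: algebra_simps)
  also have "\<dots> \<le> C * (real (Suc k))\<^sup>2"
    using assms(2) by (intro mult_left_mono) (auto simp: power2_eq_square algebra_simps)
  finally show ?case .
qed (simp add: A_0)

lemma A_ge:
  assumes "\<And>k. c * real (Suc k) \<le> a k" "c > 0"
  shows "c / 2 * (real k)\<^sup>2 \<le> A k"
proof (induction k)
  case (Suc k)
  have "c / 2 * (real (Suc k))\<^sup>2 \<le> c / 2 * ((real k)\<^sup>2 + 2 * real (Suc k))"
    using assms(2) by (intro mult_left_mono) (auto simp: power2_eq_square algebra_simps)
  also have "\<dots> = c / 2 * (real k)\<^sup>2 + c * real (Suc k)"
    by (simp add: algebra_simps)
  also have "\<dots> \<le> A (Suc k)"
    using Suc assms(1)[of k] by (simp add: A_Suc)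
  finally show ?case .
qed (simp add: A_0)

lemma S_ge:
  assumes "\<And>k. c * real (Suc k) \<le> a k" "c > 0"
  shows "c\<^sup>2 / 8 * real k ^ 4 \<le> S k"
proof (induction k)
  case (Suc k)
  \<comment> \<open>The fourth power grows by at most \<open>4 * real (Suc k) ^ 3\<close>; the
    resulting \<open>c\<^sup>2 / 2\<close> is the product of the constants \<open>c / 2\<close> of
    \<open>A_ge\<close> and \<open>c\<close>.\<close>
  have "c\<^sup>2 / 8 * real (Suc k) ^ 4 \<le> c\<^sup>2 / 8 * (real k ^ 4 + 4 * real (Suc k) ^ 3)"
    by (intro mult_left_mono) (auto simp: power_numeral_reduce algebra_simps)
  also have "\<dots> = c\<^sup>2 / 8 * real k ^ 4 + (c / 2 * (real (Suc k))\<^sup>2) * (c * real (Suc k))"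
    by (simp add: power_numeral_reduce field_simps)
  also have "\<dots> \<le> S k + A (Suc k) * a k"
    using assms by (intro add_mono Suc mult_mono A_ge A_nonneg) auto
  finally show ?case by (simp add: S_def)
qed (simp add: S_def)

lemma sum_sqrt_le:
  assumes "\<And>k. a k \<le> C * real (Suc k)" "C > 0"
  shows "(\<Sum>i<k. sqrt (A (Suc i)) * a i) \<le> sqrt C * C * real k ^ 3"
proof (induction k)
  case (Suc k)
  have "sqrt (A (Suc k)) \<le> sqrt (C * (real (Suc k))\<^sup>2)"
    using A_le[OF assms] by (rule real_sqrt_le_mono)
  also have "\<dots> = sqrt C * real (Suc k)"
    by (simp add: real_sqrt_mult del: of_nat_Suc)
  finally have "sqrt (A (Suc k)) * a k \<le> (sqrt C * real (Suc k)) * (C * real (Suc k))"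
    using assms a_nonneg by (intro mult_mono) auto
  then have "(\<Sum>i<Suc k. sqrt (A (Suc i)) * a i)
      \<le> sqrt C * C * real k ^ 3 + (sqrt C * real (Suc k)) * (C * real (Suc k))"
    using Suc by simp
  also have "\<dots> = sqrt C * C * (real k ^ 3 + (real (Suc k))\<^sup>2)"
    by (simp add: power2_eq_square algebra_simps)
  also have "\<dots> \<le> sqrt C * C * real (Suc k) ^ 3"
    using assms(2) by (intro mult_left_mono) (auto simp: power_numeral_reduce algebra_simps)
  finally show ?case .
qed simp

lemma A_div_S_bigo: "(\<lambda>k. A k / S k) \<in> O(\<lambda>k. 1 / (real k)\<^sup>2)"
proof -
  obtain c C where c: "c > 0" and C: "C > 0"
    and lo: "\<And>k. c * real (Suc k) \<le> a k" and up: "\<And>k. a k \<le> C * real (Suc k)"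
    using bigtheta_real_bounds[OF a_theta a_pos] by blast
  have "norm (A k / S k) \<le> (8 * C / c\<^sup>2) * norm (1 / (real k)\<^sup>2)" if k: "k \<ge> 1" for k
  proof -
    have "A k / S k \<le> (C * (real k)\<^sup>2) / (c\<^sup>2 / 8 * real k ^ 4)"
      using A_le[OF up C, of k] S_ge[OF lo c, of k] c C k A_nonneg by (intro frac_le) auto
    also have "\<dots> = (8 * C / c\<^sup>2) * (1 / (real k)\<^sup>2)"
      using c k by (simp add: field_simps power_numeral_reduce)
    finally show ?thesis
      using A_nonneg[of k] S_pos[OF k] by simp
  qed
  then show ?thesis
    by (intro bigoI[of _ "8 * C / c\<^sup>2"] eventually_mono[OF eventually_ge_at_top[of 1]])
qed

lemma B_tilde_bigo: "B_tilde A \<in> O(\<lambda>k. 1 / (real k)\<^sup>2)"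
proof -
  obtain c C where c: "c > 0" and C: "C > 0"
    and lo: "\<And>k. c * real (Suc k) \<le> a k" and up: "\<And>k. a k \<le> C * real (Suc k)"
    using bigtheta_real_bounds[OF a_theta a_pos] by blast
  let ?R = "\<lambda>k. \<Sum>i<k. sqrt (A (Suc i)) * a i" and ?K = "8 * (sqrt C * C) / c\<^sup>2"
  have "norm (?R k / S k) \<le> ?K * norm (1 / real k)" if k: "k \<ge> 1" for k
  proof -
    have R: "?R k \<ge> 0"
      by (intro sum_nonneg mult_nonneg_nonneg a_nonneg) (simp add: A_nonneg)
    have "?R k / S k \<le> (sqrt C * C * real k ^ 3) / (c\<^sup>2 / 8 * real k ^ 4)"
      using sum_sqrt_le[OF up C, of k] S_ge[OF lo c, of k] c C k R by (intro frac_le) auto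
    also have "\<dots> = ?K * (1 / real k)"
      using c k by (simp add: field_simps power_numeral_reduce)
    finally show ?thesis
      using R S_pos[OF k] by simp
  qed
  then have "(\<lambda>k. ?R k / S k) \<in> O(\<lambda>k. 1 / real k)"
    by (intro bigoI[of _ ?K] eventually_mono[OF eventually_ge_at_top[of 1]])
  then have "(\<lambda>k. 8 * (?R k / S k)\<^sup>2) \<in> O(\<lambda>k. (1 / real k)\<^sup>2)"
    using landau_o.big_power by fastforce
  moreover have "B_tilde A = (\<lambda>k. 8 * (?R k / S k)\<^sup>2)"
    unfolding B_tilde_def sum_sqrt_eq S_eq ..
  ultimately show ?thesis
    by (simp add: power_divide)
qed

text \<open>Linear \<open>a\<close> over quadratic \<open>A\<close> leaves \<open>1 / i\<close>, so
  a harmonic sum remains.\<close>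

lemma sum_a_div_A_bigo: "(\<lambda>k. \<Sum>i=1..<k. a i / A i) \<in> O(\<lambda>k. ln (real k))"
proof -
  obtain c C where c: "c > 0" and C: "C > 0"
    and lo: "\<And>k. c * real (Suc k) \<le> a k" and up: "\<And>k. a k \<le> C * real (Suc k)"
    using bigtheta_real_bounds[OF a_theta a_pos] by blast
  have ratio: "a i / A i \<le> 4 * C / c * (1 / real i)" if i: "i \<ge> 1" for i
  proof -
    have "C * real (Suc i) \<le> C * (2 * real i)"
      using C i by (intro mult_left_mono) auto
    then have "a i \<le> C * (2 * real i)"
      using up[of i] by (rule order_trans[rotated])
    then have "a i / A i \<le> (C * (2 * real i)) / (c / 2 * (real i)\<^sup>2)"
      using A_ge[OF lo c, of i] c C i by (intro frac_le) auto
    also have "\<dots> = 4 * C / c * (1 / real i)"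
      using c i by (simp add: field_simps power2_eq_square)
    finally show ?thesis .
  qed
  have "norm (\<Sum>i=1..<k. a i / A i) \<le> 4 * C / c * norm (\<Sum>i=1..<k. 1 / real i)" for k
  proof -
    have "(\<Sum>i=1..<k. a i / A i) \<le> (\<Sum>i=1..<k. 4 * C / c * (1 / real i))"
      by (intro sum_mono ratio) auto
    then show ?thesis
      by (simp add: sum_nonneg a_nonneg A_nonneg sum_distrib_left)
  qed
  then have "(\<lambda>k. \<Sum>i=1..<k. a i / A i) \<in> O(\<lambda>k. \<Sum>i=1..<k. 1 / real i)"
    by (intro bigoI[of _ "4 * C / c"] always_eventually) simp
  then show ?thesis
    using sum_inverse_bigo_ln by (rule landau_o.big_trans)
qed

lemma C_tilde_bigo: "C_tilde f A x0 p \<in> O(\<lambda>k. ln (real k) / (real k)\<^sup>2)"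
proof -
  let ?m = "A 1 * ((gradient f x0 - p) \<bullet> p) / real_of_ereal (dual_divergence f x0 p)"
  \<comment> \<open>The first summand of \<open>C_tilde\<close> does not depend on \<open>k\<close>
    and is dominated by the logarithm.\<close>
  have "(\<lambda>_. m) \<in> O(\<lambda>k. ln (real k))" for m :: real
    by real_asymp
  then have "(\<lambda>k. ?m + 4 * (\<Sum>i=1..<k. a i / A i)) \<in> O(\<lambda>k. ln (real k))"
    using sum_a_div_A_bigo by (intro sum_in_bigo) auto
  then have "(\<lambda>k. A k / S k * (?m + 4 * (\<Sum>i=1..<k. a i / A i)))
      \<in> O(\<lambda>k. 1 / (real k)\<^sup>2 * ln (real k))"
    by (rule landau_o.big.mult[OF A_div_S_bigo])
  moreover have "C_tilde f A x0 p = (\<lambda>k. A k / S k * (?m + 4 * (\<Sum>i=1..<k. a i / A i)))"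
    unfolding C_tilde_def S_eq ..
  ultimately show ?thesis by simp
qed

lemma C_tilde_bound_bigo:
  "(\<lambda>k. C_tilde' f A x0 p k * D + (C_tilde f A x0 p k)\<^sup>2 * D\<^sup>2 / N)
    \<in> O(\<lambda>k. ln (real k) / (real k)\<^sup>2)"
proof -
  have "(\<lambda>k. 1 / (real k)\<^sup>2) \<in> O(\<lambda>k. ln (real k) / (real k)\<^sup>2)"
    by real_asymp
  with B_tilde_bigo have B: "B_tilde A \<in> O(\<lambda>k. ln (real k) / (real k)\<^sup>2)"
    by (rule landau_o.big_trans)
  have "(\<lambda>k. B_tilde A k + 2 * C_tilde f A x0 p k) \<in> O(\<lambda>k. ln (real k) / (real k)\<^sup>2)"
    using B C_tilde_bigo[of p] by (intro sum_in_bigo) auto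
  then have 1: "(\<lambda>k. D * C_tilde' f A x0 p k) \<in> O(\<lambda>k. ln (real k) / (real k)\<^sup>2)"
    by (simp add: C_tilde'_def)
  have "(\<lambda>k. (C_tilde f A x0 p k)\<^sup>2) \<in> O(\<lambda>k. (ln (real k) / (real k)\<^sup>2)\<^sup>2)"
    by (rule landau_o.big_power[OF C_tilde_bigo])
  \<comment> \<open>Squaring gives \<open>(ln k)\<^sup>2 / k ^ 4\<close>, of smaller order than the
    linear term.\<close>
  also have "(\<lambda>k. (ln (real k) / (real k)\<^sup>2)\<^sup>2) \<in> O(\<lambda>k. ln (real k) / (real k)\<^sup>2)"
    by real_asymp
  finally have 2: "(\<lambda>k. c * (C_tilde f A x0 p k)\<^sup>2) \<in> O(\<lambda>k. ln (real k) / (real k)\<^sup>2)" for c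
    by simp
  show ?thesis
    using sum_in_bigo(1)[OF 1 2[of "D\<^sup>2 / N"]] by (simp add: mult_ac)
qed

end

theorem theorem5p5:
  fixes f :: "real ^ 'n \<Rightarrow> real" and x0 :: "real ^ 'n"
    and L :: real and A :: "nat \<Rightarrow> real"
  assumes "L > 0"
    and "f \<in> smooth_convex L"
    and "step_size_condition L A"
  shows "(\<forall>k\<ge>1. q_seq f A x0 k \<in> conj_dom f) \<and>
    (\<forall>pstar. min_norm_point (conj_dom f) pstar \<longrightarrow>
      (let D = real_of_ereal (dual_divergence f x0 pstar) in
        ((\<forall>k\<ge>1. (norm (q_seq f A x0 k - pstar))\<^sup>2 \<le> B_tilde A k * D) \<and>
         (\<lambda>k. B_tilde A k * D) \<in> O(\<lambda>k. 1 / (real k)\<^sup>2)) \<and>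
        (pstar \<noteq> 0 \<longrightarrow>
          (\<forall>k\<ge>1. (norm (q_seq f A x0 k))\<^sup>2 - (norm pstar)\<^sup>2
                  \<le> C_tilde' f A x0 pstar k * D
                     + (C_tilde f A x0 pstar k)\<^sup>2 * D\<^sup>2 / (norm pstar)\<^sup>2) \<and>
          (\<lambda>k. C_tilde' f A x0 pstar k * D
                + (C_tilde f A x0 pstar k)\<^sup>2 * D\<^sup>2 / (norm pstar)\<^sup>2)
            \<in> O(\<lambda>k. ln (real k) / (real k)\<^sup>2))))"
proof -
  interpret accelerated_gradient f x0 L A
    using assms by unfold_locales
  have B: "(\<lambda>k. B_tilde A k * D) \<in> O(\<lambda>k. 1 / (real k)\<^sup>2)" for D
    using B_tilde_bigo by (simp add: mult.commute[of _ D])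
  show ?thesis
    unfolding Let_def
  proof (intro conjI allI impI)
    fix k :: nat and p :: "real ^ 'n"
    assume k: "k \<ge> 1" and "min_norm_point (conj_dom f) p"
    \<comment> \<open>Interpreted for each \<open>p\<close> separately, because the locale fixes the
      minimum-norm point.\<close>
    then interpret accelerated_gradient_min_norm f x0 L A p
      by unfold_locales
    show "(norm (q_seq f A x0 k - p))\<^sup>2 \<le> B_tilde A k * real_of_ereal (dual_divergence f x0 p)"
      using norm_q_seq_minus_p_le[OF k] by (simp add: ddiv_def)
    show "(norm (q_seq f A x0 k))\<^sup>2 - (norm p)\<^sup>2
        \<le> C_tilde' f A x0 p k * real_of_ereal (dual_divergence f x0 p)
          + (C_tilde f A x0 p k)\<^sup>2 * (real_of_ereal (dual_divergence f x0 p))\<^sup>2 / (norm p)\<^sup>2"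
      using norm_q_seq_le[OF k] by (simp add: ddiv_def)
  qed (rule q_seq_in_conj_dom B C_tilde_bound_bigo, assumption?)+
qed

end
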